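(* Let $D$ be an oriented graph and let $k$ be an integer greater than $1$. If $\chi(D)\ge 8k-7$, then $D$ contains (as a subdigraph) an antidirected cycle of length at least $2k$.
   Context: Digraphs are finite. An oriented graph is an orientation of a simple undirected graph, i.e. a digraph with no loops, no parallel arcs and no directed cycle of length $2$. The chromatic number $\chi(D)$ of a digraph $D$ is the chromatic number of its underlying undirected graph. An oriented cycle is an orientation of an undirected cycle; it is antidirected if each of its vertices has either in-degree $2$ or out-degree $2$ in the cycle. The length of a cycle is its number of arcs. *)

theory Defs
  imports "Graph_Theory.Graph_Theory"
begin

text \<open>
  Undirected graphs are symmetric digraphs (\<^locale>\<open>graph\<close>); accordingly the underlying
  undirected graph of \<open>D\<close> is \<^term>\<open>mk_symmetric D\<close>.
\<close>

locale oriented_graph = digraph +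
  assumes no_digons: "u \<rightarrow>\<^bsub>G\<^esub> v \<Longrightarrow> \<not> v \<rightarrow>\<^bsub>G\<^esub> u"

definition proper_colouring :: "('a, 'b) pre_digraph \<Rightarrow> nat \<Rightarrow> ('a \<Rightarrow> nat) \<Rightarrow> bool" where
  "proper_colouring G n c \<longleftrightarrow>
     c ` verts G \<subseteq> {..<n} \<and> (\<forall>u v. u \<rightarrow>\<^bsub>G\<^esub> v \<longrightarrow> c u \<noteq> c v)"

text \<open>The least element exists whenever \<open>G\<close> is finite and loop-free; see below.\<close>

definition graph_chromatic_number :: "('a, 'b) pre_digraph \<Rightarrow> nat" where
  "graph_chromatic_number G = (LEAST n. \<exists>c. proper_colouring G n c)"

definition chromatic_number :: "('a, 'b) pre_digraph \<Rightarrow> nat" where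
  "chromatic_number D = graph_chromatic_number (with_proj (mk_symmetric D))"

text \<open>
  \<^term>\<open>pre_digraph.cycle\<close> is not used, since it is a directed closed walk and, in a symmetric
  digraph, traversing an edge back and forth satisfies it.
\<close>

definition undirected_cycle :: "('a, 'b) pre_digraph \<Rightarrow> bool" where
  "undirected_cycle G \<longleftrightarrow> graph G \<and>
     (\<exists>vs. distinct vs \<and> 3 \<le> length vs \<and> verts G = set vs \<and>
        (\<forall>u v. u \<rightarrow>\<^bsub>G\<^esub> v \<longleftrightarrow>
           (\<exists>i<length vs. {u, v} = {vs ! i, vs ! (Suc i mod length vs)})))"

definition oriented_cycle :: "('a, 'b) pre_digraph \<Rightarrow> bool" where
  "oriented_cycle C \<longleftrightarrow> oriented_graph C \<and> undirected_cycle (with_proj (mk_symmetric C))"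

definition antidirected_cycle :: "('a, 'b) pre_digraph \<Rightarrow> bool" where
  "antidirected_cycle C \<longleftrightarrow> oriented_cycle C \<and>
     (\<forall>v \<in> verts C. in_degree C v = 2 \<or> out_degree C v = 2)"

lemma ex_proper_colouring:
  assumes "digraph G"
  shows "\<exists>c. proper_colouring G (card (verts G)) c"
proof -
  interpret digraph G by fact
  obtain c :: "'a \<Rightarrow> nat" where c: "bij_betw c (verts G) {0..<card (verts G)}"
    using ex_bij_betw_finite_nat[OF finite_verts] by blast
  have "c u \<noteq> c v" if "u \<rightarrow>\<^bsub>G\<^esub> v" for u v
    using that c adj_in_verts[OF that] adj_not_same[of u]
    by (auto dest!: bij_betw_imp_inj_on inj_onD[of c _ u v])
  moreover have "c ` verts G \<subseteq> {..<card (verts G)}"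
    using c by (auto simp: bij_betw_def)
  ultimately show ?thesis unfolding proper_colouring_def by blast
qed

lemma chromatic_number_attained:
  assumes "digraph D"
  shows "\<exists>c. proper_colouring (with_proj (mk_symmetric D)) (chromatic_number D) c"
proof -
  interpret digraph D by fact
  interpret S: pair_digraph "mk_symmetric D" by (rule digraph_mk_symmetric)
  have "digraph (with_proj (mk_symmetric D))" by unfold_locales
  from ex_proper_colouring[OF this]
  have "\<exists>n c. proper_colouring (with_proj (mk_symmetric D)) n c" by blast
  from LeastI_ex[OF this]
  show ?thesis unfolding chromatic_number_def graph_chromatic_number_def .
qed

end

theory Submission
  imports Defs
begin

text \<open>
  A cycle is antidirected as soon as there are disjoint sets \<open>A\<close> and \<open>B\<close> such that all its arcs
  lead from \<open>A\<close> to \<open>B\<close>: its vertices are then alternately sources and sinks of the cycle. So it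
  suffices to find a long cycle in the undirected bipartite graph formed by the arcs from \<open>A\<close> to
  \<open>B\<close>, for a good choice of \<open>A\<close> and \<open>B\<close>.

  A graph that is not \<open>(8k - 8)\<close>-colourable has a nonempty vertex set \<open>X\<close> inducing minimum degree
  at least \<open>8k - 8\<close>, because otherwise greedy colouring along a degeneracy order would succeed
  (\<open>degenerate_colouring\<close>). Hence at least \<open>(4k - 4) |X|\<close> edges lie inside \<open>X\<close>. Some cut of \<open>X\<close>
  contains half of them (\<open>half_cut\<close>), and one of the two directions across the cut accounts for
  half of these again. This leaves \<open>(k - 1) |X|\<close> arcs from one side \<open>A\<close> to the other side \<open>B\<close>.

  Repeatedly deleting a vertex of degree at most \<open>k - 1\<close> keeps the number of edges at least
  \<open>k - 1\<close> times the number of vertices, so it has to stop, and it does so at a nonempty subgraph of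
  minimum degree at least \<open>k\<close> (\<open>ex_min_degree_subset\<close>). On a longest path of this bipartite
  subgraph, the at least \<open>k\<close> neighbours of the first vertex all lie on the path, at odd distances
  from it. The last of them therefore has distance at least \<open>2k - 1\<close> and closes a cycle of length
  at least \<open>2k\<close> (\<open>long_cycle_bipartite\<close>). Bipartiteness is what doubles the length here.

  The combinatorial part is phrased for symmetric irreflexive relations \<open>S\<close>, in which every
  undirected edge appears as two pairs, and \<open>card (S `` {v} \<inter> X)\<close> is the degree of \<open>v\<close> into \<open>X\<close>.
\<close>

section \<open>Degrees, colourings and cuts\<close>

lemma card_edges_insert:
  fixes S :: "'a rel"
  assumes "sym S" "irrefl S" "finite V"
  shows "card (S \<inter> insert v V \<times> insert v V) \<le> card (S \<inter> V \<times> V) + 2 * card (S `` {v} \<inter> V)"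
proof -
  let ?N = "S `` {v} \<inter> V"
  have "S \<inter> insert v V \<times> insert v V \<subseteq> (S \<inter> V \<times> V) \<union> ({v} \<times> ?N \<union> ?N \<times> {v})"
    using assms(1,2) by (auto simp: irrefl_def dest: symD)
  then have "card (S \<inter> insert v V \<times> insert v V) \<le> card ((S \<inter> V \<times> V) \<union> ({v} \<times> ?N \<union> ?N \<times> {v}))"
    using assms(3) by (intro card_mono) auto
  also have "\<dots> \<le> card (S \<inter> V \<times> V) + (card ({v} \<times> ?N) + card (?N \<times> {v}))"
    by (meson add_left_mono card_Un_le order_trans)
  finally show ?thesis by (simp add: card_cartesian_product)
qed

text \<open>
  Greedy colouring: a vertex of degree less than \<open>d\<close> is coloured last, when its neighbours block
  fewer than \<open>d\<close> of the \<open>d\<close> colours.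
\<close>

lemma degenerate_colouring:
  assumes "finite V" "sym S" "irrefl S"
    and "\<And>X. X \<subseteq> V \<Longrightarrow> X \<noteq> {} \<Longrightarrow> \<exists>v\<in>X. card (S `` {v} \<inter> X) < d"
  shows "\<exists>c. c ` V \<subseteq> {..<d} \<and> (\<forall>u\<in>V. \<forall>v\<in>V. (u, v) \<in> S \<longrightarrow> c u \<noteq> c v)"
  using assms(1,4)
proof (induction V rule: finite_psubset_induct)
  case (psubset V)
  show ?case
  proof (cases "V = {}")
    case False
    then obtain v where v: "v \<in> V" "card (S `` {v} \<inter> V) < d"
      using psubset.prems[of V] by blast
    have "V - {v} \<subset> V" using v by blast
    moreover have "\<exists>w\<in>X. card (S `` {w} \<inter> X) < d" if "X \<subseteq> V - {v}" "X \<noteq> {}" for X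
      using psubset.prems[of X] that by blast
    ultimately have "\<exists>c. c ` (V - {v}) \<subseteq> {..<d} \<and>
        (\<forall>u\<in>V - {v}. \<forall>w\<in>V - {v}. (u, w) \<in> S \<longrightarrow> c u \<noteq> c w)"
      by (rule psubset.IH)
    then obtain c where c: "c ` (V - {v}) \<subseteq> {..<d}"
      "\<forall>u\<in>V - {v}. \<forall>w\<in>V - {v}. (u, w) \<in> S \<longrightarrow> c u \<noteq> c w"
      by (elim exE conjE)
    have "card (c ` (S `` {v} \<inter> V)) < card {..<d}"
      using v(2) card_image_le[of "S `` {v} \<inter> V" c] psubset.hyps by simp
    then obtain x where x: "x < d" "x \<notin> c ` (S `` {v} \<inter> V)"
      by (metis card_mono finite_Int finite_imageI lessThan_iff not_le psubset.hyps(1) subsetI)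
    have "(c(v := x)) ` V \<subseteq> {..<d}" using c(1) x(1) by auto
    moreover have "(c(v := x)) u \<noteq> (c(v := x)) w" if "u \<in> V" "w \<in> V" "(u, w) \<in> S" for u w
    proof -
      have "u \<noteq> w" "(w, u) \<in> S" using that(3) assms(2,3) by (auto simp: irrefl_def dest: symD)
      then show ?thesis using c(2) x(2) that by auto
    qed
    ultimately show ?thesis by blast
  qed simp
qed

text \<open>
  Vertices are placed one at a time, each on the side opposite to the majority of its neighbours
  already placed, so that at least half of its new edges are cut. The factor is 4 rather than 2
  because the left-hand side counts every edge in both orders and the right-hand side counts only
  the pairs that lead out of \<open>A\<close>.
\<close>

lemma half_cut:
  assumes "finite V" "sym S" "irrefl S"
  shows "\<exists>A\<subseteq>V. card (S \<inter> V \<times> V) \<le> 4 * card (S \<inter> A \<times> (V - A))"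
  using assms(1)
proof (induction V rule: finite_induct)
  case (insert v V)
  then obtain A where A: "A \<subseteq> V" "card (S \<inter> V \<times> V) \<le> 4 * card (S \<inter> A \<times> (V - A))"
    by blast
  define N where "N = S `` {v} \<inter> V"
  have fin: "finite A" "finite V" "finite N"
    using A(1) insert.hyps(1) by (auto simp: N_def intro: finite_subset)
  have N: "card N = card (N \<inter> A) + card (N \<inter> (V - A))"
    using fin by (subst card_Un_disjoint[symmetric]) (auto simp: N_def intro: arg_cong[where f = card])
  have le: "card (S \<inter> insert v V \<times> insert v V) \<le> card (S \<inter> V \<times> V) + 2 * card N"
    unfolding N_def using assms(2,3) insert.hyps(1) by (rule card_edges_insert)
  show ?case
  proof (cases "card (N \<inter> A) \<le> card (N \<inter> (V - A))")
    case True
    let ?A = "insert v A"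
    have "S \<inter> ?A \<times> (insert v V - ?A) = (S \<inter> A \<times> (V - A)) \<union> {v} \<times> (N \<inter> (V - A))"
      using insert.hyps(2) by (auto simp: N_def)
    moreover have "card \<dots> = card (S \<inter> A \<times> (V - A)) + card (N \<inter> (V - A))"
      using fin A(1) insert.hyps(2)
      by (subst card_Un_disjoint) (auto simp: card_cartesian_product)
    ultimately show ?thesis using le A N True by (intro exI[of _ ?A]) auto
  next
    case False
    have "S \<inter> A \<times> (insert v V - A) = (S \<inter> A \<times> (V - A)) \<union> (N \<inter> A) \<times> {v}"
      using insert.hyps(2) A(1) assms(2) by (auto simp: N_def dest: symD)
    moreover have "card \<dots> = card (S \<inter> A \<times> (V - A)) + card (N \<inter> A)"
      using fin A(1) insert.hyps(2)
      by (subst card_Un_disjoint) (auto simp: card_cartesian_product)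
    ultimately show ?thesis using le A N False by (intro exI[of _ A]) auto
  qed
qed simp

text \<open>
  The hypothesis says that there are at least \<open>d * card V\<close> edges. Deleting a vertex of degree at most
  \<open>d\<close> preserves it, and the deletions cannot go on down to a single vertex, which would have to
  carry at least \<open>d > 0\<close> edges.
\<close>

lemma ex_min_degree_subset:
  assumes "finite V" "sym S" "irrefl S" "0 < d" "V \<noteq> {}"
    and "2 * d * card V \<le> card (S \<inter> V \<times> V)"
  shows "\<exists>W\<subseteq>V. W \<noteq> {} \<and> (\<forall>v\<in>W. d < card (S `` {v} \<inter> W))"
  using assms(1,5,6)
proof (induction V rule: finite_psubset_induct)
  case (psubset V)
  show ?case
  proof (cases "\<forall>v\<in>V. d < card (S `` {v} \<inter> V)")
    case True
    then show ?thesis using psubset.prems by blast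
  next
    case False
    then obtain v where v: "v \<in> V" "card (S `` {v} \<inter> V) \<le> d" by force
    let ?V = "V - {v}"
    have "card (S `` {v} \<inter> ?V) \<le> d"
      using v(2) psubset.hyps by (meson card_mono Diff_subset Int_mono finite_Int order_refl order_trans)
    moreover have "card (S \<inter> V \<times> V) \<le> card (S \<inter> ?V \<times> ?V) + 2 * card (S `` {v} \<inter> ?V)"
      using card_edges_insert[OF assms(2,3), of ?V v] psubset.hyps v(1) by (simp add: insert_absorb)
    moreover have "card V = Suc (card ?V)"
      using v(1) psubset.hyps by (metis card_Suc_Diff1)
    ultimately have edges: "2 * d * card ?V \<le> card (S \<inter> ?V \<times> ?V)"
      using psubset.prems(2) by simp
    have "?V \<noteq> {}"
    proof
      assume "?V = {}"
      then have "V = {v}" using v(1) by blast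
      then show False using psubset.prems(2) assms(3,4) by (auto simp: irrefl_def)
    qed
    then show ?thesis using psubset.IH[of ?V] edges v(1) by blast
  qed
qed

section \<open>Long cycles in bipartite graphs of large minimum degree\<close>

lemma long_cycle_bipartite:
  assumes "finite W" "W \<noteq> {}" "sym S" "0 < k"
    and bip: "\<And>u v. (u, v) \<in> S \<Longrightarrow> u \<in> A \<longleftrightarrow> v \<notin> A"
    and deg: "\<And>v. v \<in> W \<Longrightarrow> k \<le> card (S `` {v} \<inter> W)"
  shows "\<exists>vs. distinct vs \<and> set vs \<subseteq> W \<and> 2 * k \<le> length vs \<and>
    (\<forall>i<length vs. (vs ! i, vs ! (Suc i mod length vs)) \<in> S)"
proof -
  define P where "P p \<longleftrightarrow> p \<noteq> [] \<and> distinct p \<and> set p \<subseteq> W \<and>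
    (\<forall>i. Suc i < length p \<longrightarrow> (p ! i, p ! Suc i) \<in> S)" for p
  obtain w where "w \<in> W" using assms(2) by blast
  then have "P [w]" by (simp add: P_def)
  moreover have "\<forall>p. P p \<longrightarrow> length p < Suc (card W)"
    using assms(1) by (metis P_def card_mono distinct_card le_imp_less_Suc)
  ultimately obtain p where p: "P p" and longest: "\<And>q. P q \<Longrightarrow> length q \<le> length p"
    using ex_has_greatest_nat[of P "[w]" length "Suc (card W)"] by blast
  have pW: "p ! 0 \<in> W" "p \<noteq> []" "distinct p" "set p \<subseteq> W"
    and step: "\<And>i. Suc i < length p \<Longrightarrow> (p ! i, p ! Suc i) \<in> S"
    using p by (auto simp: P_def)
  define J where "J = {j. j < length p \<and> (p ! 0, p ! j) \<in> S}"
  have nbr: "S `` {p ! 0} \<inter> W \<subseteq> (!) p ` J"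
  proof
    fix u assume u: "u \<in> S `` {p ! 0} \<inter> W"
    have "u \<in> set p"
    proof (rule ccontr)
      assume "u \<notin> set p"
      have "((u # p) ! i, (u # p) ! Suc i) \<in> S" if "Suc i < length (u # p)" for i
        using that u step assms(3) by (cases i) (auto dest: symD)
      then have "P (u # p)" using \<open>u \<notin> set p\<close> u pW unfolding P_def by auto
      then show False using longest by fastforce
    qed
    then show "u \<in> (!) p ` J" using u by (auto simp: J_def in_set_conv_nth)
  qed
  have finJ: "finite J" by (simp add: J_def)
  have cardJ: "k \<le> card J"
    using deg[OF pW(1)] card_mono[OF _ nbr] card_image_le[OF finJ, of "(!) p"] finJ by simp
  have parity: "p ! i \<in> A \<longleftrightarrow> (p ! 0 \<in> A) = even i" if "i < length p" for i
    using that
  proof (induction i)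
    case (Suc i)
    then show ?case using bip[OF step[of i]] by auto
  qed simp
  \<comment> \<open>The path alternates between the two classes, so neighbours of its first vertex have odd index.\<close>
  have odd: "odd j" if "j \<in> J" for j
    using that parity[of j] bip[of "p ! 0" "p ! j"] by (auto simp: J_def)
  \<comment> \<open>Only \<open>k - 1\<close> odd numbers are smaller than \<open>2 * k - 1\<close>.\<close>
  have "\<exists>j\<in>J. 2 * k \<le> Suc j"
  proof (rule ccontr)
    assume "\<not> ?thesis"
    then have small: "Suc j < 2 * k" if "j \<in> J" for j using that by (meson not_le)
    have "J \<subseteq> (\<lambda>i. 2 * i + 1) ` {..<k - 1}"
    proof
      fix j assume "j \<in> J"
      then obtain i where "j = 2 * i + 1" using odd by (meson oddE)
      moreover have "i < k - 1" using small[OF \<open>j \<in> J\<close>] calculation by simp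
      ultimately show "j \<in> (\<lambda>i. 2 * i + 1) ` {..<k - 1}" by blast
    qed
    then have "card J \<le> k - 1" by (metis card_lessThan finite_lessThan surj_card_le)
    then show False using cardJ assms(4) by simp
  qed
  then obtain j where j: "j \<in> J" "2 * k \<le> Suc j" by blast
  define vs where "vs = take (Suc j) p"
  have len: "length vs = Suc j" using j(1) by (simp add: vs_def J_def)
  have "(vs ! i, vs ! (Suc i mod length vs)) \<in> S" if "i < length vs" for i
  proof (cases "i = j")
    case True
    then show ?thesis using len j(1) assms(3) by (auto simp: vs_def J_def dest: symD)
  next
    case False
    then show ?thesis using len that j(1) step[of i] by (auto simp: vs_def J_def)
  qed
  moreover have "distinct vs" "set vs \<subseteq> W"
    using pW by (auto simp: vs_def dest: in_set_takeD)
  ultimately show ?thesis using len j(2) by auto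
qed

section \<open>From vertex sequences to antidirected cycles\<close>

definition cyclic_edge :: "'a list \<Rightarrow> nat \<Rightarrow> 'a set" where
  "cyclic_edge vs i = {vs ! i, vs ! (Suc i mod length vs)}"

text \<open>
  The length must be at least 3 here and below: on two vertices, both cyclic edges coincide.
\<close>

lemma inj_on_cyclic_edge:
  assumes "distinct vs" "3 \<le> length vs"
  shows "inj_on (cyclic_edge vs) {..<length vs}"
proof (rule inj_onI)
  let ?n = "length vs"
  fix i j assume *: "i \<in> {..<?n}" "j \<in> {..<?n}" "cyclic_edge vs i = cyclic_edge vs j"
  have s: "Suc i mod ?n < ?n" "Suc j mod ?n < ?n" using assms(2) by (auto intro: mod_less_divisor)
  show "i = j"
  proof (rule ccontr)
    assume "i \<noteq> j"
    then have "vs ! i = vs ! (Suc j mod ?n)" "vs ! j = vs ! (Suc i mod ?n)"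
      using * assms(1) by (auto simp: cyclic_edge_def doubleton_eq_iff nth_eq_iff_index_eq)
    then have "i = Suc j mod ?n" "j = Suc i mod ?n"
      using * s assms(1) by (auto simp: nth_eq_iff_index_eq)
    moreover have "Suc m mod ?n = (if Suc m = ?n then 0 else Suc m)" if "m < ?n" for m
      using that by (simp add: mod_Suc)
    ultimately have "i = 0 \<and> Suc j = ?n \<or> i = Suc j" "j = 0 \<and> Suc i = ?n \<or> j = Suc i"
      using *(1,2) by (metis lessThan_iff)+
    then show False using assms(2) by (elim disjE conjE) linarith+
  qed
qed

lemma card_cyclic_neighbours:
  assumes "distinct vs" "3 \<le> length vs" "v \<in> set vs"
  shows "card {u. \<exists>i<length vs. {v, u} = cyclic_edge vs i} = 2"
proof -
  let ?n = "length vs"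
  obtain j where j: "j < ?n" "v = vs ! j" using assms(3) by (auto simp: in_set_conv_nth)
  define p where "p = (if j = 0 then ?n - 1 else j - 1)"
  have p: "p < ?n" "Suc p mod ?n = j" using j assms(2) by (auto simp: p_def)
  have s: "Suc j mod ?n < ?n" using assms(2) by (auto intro: mod_less_divisor)
  have "{u. \<exists>i<?n. {v, u} = cyclic_edge vs i} = {vs ! (Suc j mod ?n), vs ! p}" (is "?L = ?R")
  proof
    show "?R \<subseteq> ?L" using j p by (auto simp: cyclic_edge_def)
    show "?L \<subseteq> ?R"
    proof
      fix u assume "u \<in> ?L"
      then obtain i where i: "i < ?n" "{v, u} = cyclic_edge vs i" by blast
      have "Suc i mod ?n < ?n" using assms(2) by (auto intro: mod_less_divisor)
      then consider "i = j" "u = vs ! (Suc j mod ?n)" | "Suc i mod ?n = j" "u = vs ! i"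
        using i j assms(1) by (auto simp: cyclic_edge_def doubleton_eq_iff nth_eq_iff_index_eq)
      then show "u \<in> ?R"
      proof cases
        case 2
        then have "i = p" using p i(1) by (auto simp: mod_Suc split: if_splits)
        then show ?thesis using 2 by simp
      qed simp
    qed
  qed
  moreover have "Suc j mod ?n \<noteq> p" using j assms(2) by (auto simp: p_def mod_Suc)
  ultimately show ?thesis using s p(1) assms(1) by (simp add: nth_eq_iff_index_eq)
qed

text \<open>
  The arcs of \<open>C\<close> are those whose ends form a cyclic edge of \<open>vs\<close>. Since \<open>A\<close> and \<open>B\<close> are disjoint, both
  cycle edges at a vertex in \<open>A\<close> are directed out of it, and both cycle edges at a vertex in \<open>B\<close>
  are directed into it.
\<close>

lemma (in oriented_graph) antidirected_cycle_of_bipartite_cycle: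
  assumes F: "F \<subseteq> arcs_ends G" "F \<subseteq> A \<times> B" "A \<inter> B = {}"
    and vs: "distinct vs" "3 \<le> length vs"
    and cyc: "\<And>i. i < length vs \<Longrightarrow> (vs ! i, vs ! (Suc i mod length vs)) \<in> F \<union> F\<inverse>"
  shows "\<exists>C. subgraph C G \<and> antidirected_cycle C \<and> length vs \<le> card (arcs C)"
proof -
  let ?n = "length vs"
  define on_cycle where "on_cycle u v \<longleftrightarrow> (\<exists>i<?n. {u, v} = cyclic_edge vs i)" for u v
  define C where "C = \<lparr>verts = set vs,
    arcs = {a \<in> arcs G. (tail G a, head G a) \<in> F \<and> on_cycle (tail G a) (head G a)},
    tail = tail G, head = head G\<rparr>"
  have on_sym: "on_cycle u v \<longleftrightarrow> on_cycle v u" for u v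
    by (simp add: on_cycle_def insert_commute)
  have on_set: "u \<in> set vs" if uv: "on_cycle u v" for u v
  proof -
    obtain i where i: "i < ?n" "{u, v} = cyclic_edge vs i" using uv unfolding on_cycle_def by blast
    have "Suc i mod ?n < ?n" using vs(2) by (auto intro: mod_less_divisor)
    then show ?thesis using i by (auto simp: cyclic_edge_def doubleton_eq_iff)
  qed
  have on_F: "(u, v) \<in> F \<or> (v, u) \<in> F" if "on_cycle u v" for u v
    using that cyc by (auto simp: on_cycle_def cyclic_edge_def doubleton_eq_iff)
  have ends_C: "arcs_ends C = {(u, v) \<in> F. on_cycle u v}"
    using F(1) by (auto simp: C_def arcs_ends_conv)
  have next_on: "on_cycle (vs ! i) (vs ! (Suc i mod ?n))" if "i < ?n" for i
    using that by (auto simp: on_cycle_def cyclic_edge_def)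
  have "set vs \<subseteq> verts G"
  proof
    fix v assume "v \<in> set vs"
    then obtain i where "i < ?n" "v = vs ! i" by (auto simp: in_set_conv_nth)
    then show "v \<in> verts G" using cyc[of i] F(1) by (auto dest: adj_in_verts)
  qed
  moreover have wf: "wf_digraph C"
    using on_set on_sym by unfold_locales (auto simp: C_def)
  ultimately have sub: "subgraph C G"
    by (auto simp: subgraph_def C_def compatible_def wf_digraph)
  interpret C: wf_digraph C by (rule wf)
  have orC: "oriented_graph C"
  proof
    show "finite (verts C)" "finite (arcs C)" by (auto simp: C_def)
    show "tail C a \<noteq> head C a" if "a \<in> arcs C" for a
      using that no_loops by (auto simp: C_def)
    show "a = b" if "a \<in> arcs C" "b \<in> arcs C" "arc_to_ends C a = arc_to_ends C b" for a b
      using that no_multi_arcs[of a b] by (auto simp: C_def arc_to_ends_def)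
    show "\<not> v \<rightarrow>\<^bsub>C\<^esub> u" if "u \<rightarrow>\<^bsub>C\<^esub> v" for u v
      using that F by (auto simp: ends_C)
  qed
  then interpret C: oriented_graph C .
  have dom: "(u, v) \<in> parcs (mk_symmetric C) \<longleftrightarrow> on_cycle u v" for u v
  proof -
    have "(u, v) \<in> parcs (mk_symmetric C) \<longleftrightarrow> (u, v) \<in> arcs_ends C \<or> (v, u) \<in> arcs_ends C"
      by (auto simp: parcs_mk_symmetric arcs_ends_conv)
    then show ?thesis using on_F on_sym by (auto simp: ends_C)
  qed
  interpret S: pair_digraph "mk_symmetric C" by (rule C.digraph_mk_symmetric)
  have "graph (with_proj (mk_symmetric C))"
    using S.graphI symmetric_mk_symmetric by blast
  then have "undirected_cycle (with_proj (mk_symmetric C))"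
    unfolding undirected_cycle_def using vs dom
    by (intro conjI exI[of _ vs]) (auto simp: C_def on_cycle_def cyclic_edge_def)
  then have ocyc: "oriented_cycle C" using orC by (simp add: oriented_cycle_def)
  have nbrs: "card {u. on_cycle v u} = 2" if "v \<in> set vs" for v
    unfolding on_cycle_def using vs that by (rule card_cyclic_neighbours)
  have "in_degree C v = 2 \<or> out_degree C v = 2" if v: "v \<in> set vs" for v
  proof -
    obtain i where i: "i < ?n" "v = vs ! i" using v by (auto simp: in_set_conv_nth)
    then consider "v \<in> A" | "v \<in> B" using cyc[of i] F(2) by auto
    then show ?thesis
    proof cases
      case 1
      have "inj_on (head C) (out_arcs C v)"
        using C.no_multi_arcs by (auto simp: inj_on_def arc_to_ends_def)
      moreover have "head C ` out_arcs C v = {u. (v, u) \<in> arcs_ends C}"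
        by (force simp: arcs_ends_conv)
      moreover have "\<dots> = {u. on_cycle v u}"
        using 1 F(2,3) on_F by (auto simp: ends_C)
      ultimately show ?thesis using nbrs[OF v] by (metis card_image out_degree_def)
    next
      case 2
      have "inj_on (tail C) (in_arcs C v)"
        using C.no_multi_arcs by (auto simp: inj_on_def arc_to_ends_def)
      moreover have "tail C ` in_arcs C v = {u. (u, v) \<in> arcs_ends C}"
        by (force simp: arcs_ends_conv)
      moreover have "\<dots> = {u. on_cycle v u}"
        using 2 F(2,3) on_F on_sym by (auto simp: ends_C)
      ultimately show ?thesis using nbrs[OF v] by (metis card_image in_degree_def)
    qed
  qed
  then have "antidirected_cycle C" using ocyc by (simp add: antidirected_cycle_def C_def)
  moreover have "?n \<le> card (arcs C)"
  proof -
    have "cyclic_edge vs ` {..<?n} \<subseteq> (\<lambda>a. {tail C a, head C a}) ` arcs C"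
    proof clarify
      fix i assume "i < ?n"
      then have "on_cycle (vs ! i) (vs ! (Suc i mod ?n))" by (rule next_on)
      then have "(vs ! i, vs ! (Suc i mod ?n)) \<in> arcs_ends C \<or> (vs ! (Suc i mod ?n), vs ! i) \<in> arcs_ends C"
        using on_F on_sym by (auto simp: ends_C)
      then show "cyclic_edge vs i \<in> (\<lambda>a. {tail C a, head C a}) ` arcs C"
        by (auto simp: cyclic_edge_def arcs_ends_conv insert_commute)
    qed
    then have "card (cyclic_edge vs ` {..<?n}) \<le> card (arcs C)"
      by (meson C.finite_arcs surj_card_le)
    then show ?thesis using inj_on_cyclic_edge[OF vs] by (simp add: card_image)
  qed
  ultimately show ?thesis using sub by blast
qed

section \<open>Antidirected cycles from large chromatic number\<close>

lemma antidirected_cycle_of_dense_cut: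
  assumes "oriented_graph D" "1 < k" "finite X" "X \<noteq> {}" "A \<inter> B = {}" "A \<union> B \<subseteq> X"
    and "(k - 1) * card X \<le> card (arcs_ends D \<inter> A \<times> B)"
  shows "\<exists>C. subgraph C D \<and> antidirected_cycle C \<and> 2 * k \<le> card (arcs C)"
proof -
  interpret oriented_graph D by fact
  define F where "F = arcs_ends D \<inter> A \<times> B"
  let ?S = "F \<union> F\<inverse>"
  have F: "F \<subseteq> arcs_ends D" "F \<subseteq> A \<times> B" by (auto simp: F_def)
  have "finite F" using F(1) by (rule finite_subset) (simp add: arcs_ends_def)
  moreover have "F \<inter> F\<inverse> = {}" using F(2) assms(5) by auto
  ultimately have "card ?S = 2 * card F" by (simp add: card_Un_disjoint)
  moreover have "?S \<inter> X \<times> X = ?S" using F(2) assms(6) by auto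
  ultimately have dense: "2 * (k - 1) * card X \<le> card (?S \<inter> X \<times> X)"
    using assms(7) by (simp add: F_def)
  have S: "sym ?S" "irrefl ?S" using F(2) assms(5) by (auto simp: sym_def irrefl_def)
  obtain W where W: "W \<subseteq> X" "W \<noteq> {}" "\<And>v. v \<in> W \<Longrightarrow> k - 1 < card (?S `` {v} \<inter> W)"
    using ex_min_degree_subset[OF assms(3) S _ assms(4) dense] assms(2) by auto
  have "finite W" using W(1) assms(3) by (rule finite_subset)
  moreover have "u \<in> A \<longleftrightarrow> v \<notin> A" if "(u, v) \<in> ?S" for u v
    using that F(2) assms(5) by auto
  moreover have "k \<le> card (?S `` {v} \<inter> W)" if "v \<in> W" for v using W(3)[OF that] by simp
  ultimately obtain vs where vs: "distinct vs" "2 * k \<le> length vs"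
    "\<And>i. i < length vs \<Longrightarrow> (vs ! i, vs ! (Suc i mod length vs)) \<in> ?S"
    using long_cycle_bipartite[of W ?S k A] W(2) S(1) assms(2) by auto
  moreover have "3 \<le> length vs" using vs(2) assms(2) by simp
  ultimately show ?thesis
    using antidirected_cycle_of_bipartite_cycle[OF F assms(5), of vs] by (meson order_trans)
qed

theorem theorem13:
  fixes D :: "('a, 'b) pre_digraph" and k :: nat
  assumes "oriented_graph D" and "k > 1" and "chromatic_number D \<ge> 8 * k - 7"
  shows "\<exists>C. subgraph C D \<and> antidirected_cycle C \<and> card (arcs C) \<ge> 2 * k"
proof -
  interpret oriented_graph D by fact
  let ?E = "arcs_ends D"
  let ?S = "?E \<union> ?E\<inverse>"
  have S: "sym ?S" "irrefl ?S" by (auto simp: sym_def irrefl_def dest: adj_not_same)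
  have "\<exists>X\<subseteq>verts D. X \<noteq> {} \<and> (\<forall>v\<in>X. 8 * k - 8 \<le> card (?S `` {v} \<inter> X))"
  proof (rule ccontr)
    assume "\<not> ?thesis"
    then have low: "\<exists>v\<in>X. card (?S `` {v} \<inter> X) < 8 * k - 8" if "X \<subseteq> verts D" "X \<noteq> {}" for X
      using that by (meson not_le)
    have "\<exists>c. c ` verts D \<subseteq> {..<8 * k - 8} \<and>
        (\<forall>u\<in>verts D. \<forall>v\<in>verts D. (u, v) \<in> ?S \<longrightarrow> c u \<noteq> c v)"
      using finite_verts S low by (rule degenerate_colouring)
    then obtain c where c: "c ` verts D \<subseteq> {..<8 * k - 8}"
      "\<forall>u\<in>verts D. \<forall>v\<in>verts D. (u, v) \<in> ?S \<longrightarrow> c u \<noteq> c v"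
      by (elim exE conjE)
    have "parcs (mk_symmetric D) = ?S" by (auto simp: parcs_mk_symmetric arcs_ends_conv)
    moreover have "u \<in> verts D \<and> v \<in> verts D" if "(u, v) \<in> ?S" for u v
      using that by (auto dest: adj_in_verts)
    ultimately have "proper_colouring (with_proj (mk_symmetric D)) (8 * k - 8) c"
      using c unfolding proper_colouring_def by (metis pverts_mk_symmetric with_proj_simps(1,3))
    then have "chromatic_number D \<le> 8 * k - 8"
      unfolding chromatic_number_def graph_chromatic_number_def by (blast intro: Least_le)
    then show False using assms(2,3) by simp
  qed
  then obtain X where X: "X \<subseteq> verts D" "X \<noteq> {}" "\<And>v. v \<in> X \<Longrightarrow> 8 * k - 8 \<le> card (?S `` {v} \<inter> X)"
    by blast
  have finX: "finite X" using X(1) finite_verts by (rule finite_subset)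
  \<comment> \<open>Summing degrees counts every edge inside \<open>X\<close> in both orders, as \<open>?S\<close> does.\<close>
  have "(8 * k - 8) * card X \<le> (\<Sum>v\<in>X. card (?S `` {v} \<inter> X))"
    using sum_mono[of X "\<lambda>_. 8 * k - 8"] X(3) by (simp add: mult.commute)
  also have "\<dots> = card (SIGMA v:X. ?S `` {v} \<inter> X)" using finX by simp
  also have "(SIGMA v:X. ?S `` {v} \<inter> X) = ?S \<inter> X \<times> X" by auto
  finally have deg: "(8 * k - 8) * card X \<le> card (?S \<inter> X \<times> X)" .
  obtain A where A: "A \<subseteq> X" "card (?S \<inter> X \<times> X) \<le> 4 * card (?S \<inter> A \<times> (X - A))"
    using half_cut[OF finX S] by blast
  \<comment> \<open>The pairs of \<open>?S\<close> that leave \<open>A\<close> are the arcs out of \<open>A\<close> and the reversed arcs into \<open>A\<close>.\<close>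
  have "card (?S \<inter> A \<times> (X - A)) = card ((?E \<inter> A \<times> (X - A)) \<union> (?E \<inter> (X - A) \<times> A)\<inverse>)"
    by (rule arg_cong[where f = card]) auto
  also have "\<dots> \<le> card (?E \<inter> A \<times> (X - A)) + card (?E \<inter> (X - A) \<times> A)"
    by (metis card_Un_le card_inverse)
  finally have "2 * ((k - 1) * card X) \<le> card (?E \<inter> A \<times> (X - A)) + card (?E \<inter> (X - A) \<times> A)"
    using deg A(2) by (simp add: diff_mult_distrib)
  then consider "(k - 1) * card X \<le> card (?E \<inter> A \<times> (X - A))"
    | "(k - 1) * card X \<le> card (?E \<inter> (X - A) \<times> A)"
    by linarith
  then show ?thesis
  proof cases
    case 1
    show ?thesis
      by (rule antidirected_cycle_of_dense_cut[OF assms(1,2) finX X(2) _ _ 1]) (use A(1) in auto)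
  next
    case 2
    show ?thesis
      by (rule antidirected_cycle_of_dense_cut[OF assms(1,2) finX X(2) _ _ 2]) (use A(1) in auto)
  qed
qed

end
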